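(* Let $n\ge 1$. The following three assertions are mutually equivalent. (1) For any positive invertible matrix $A$ and any normal invertible matrix $B$ in $M_n(\mathbb{C})$, $$\|A\sharp (B^{*}A^{-1}B)\|\geq \|B\|.$$ (2) For any positive invertible matrix $S$, any unitary matrix $U$ and any positive invertible matrix $D$ in $M_n(\mathbb{C})$ with $UD=DU$, $$\|D^{\frac12}\,\bigl(S\sharp (U^{*}S^{-1}U)\bigr)\, D^{\frac12}\|\geq \|D\|.$$ (3) For any positive invertible matrix $S$ and any unitary matrix $U$ in $M_n(\mathbb{C})$, $$E_U\bigl(S\sharp (U^{*}S^{-1}U)\bigr)\geq I.$$
   Context: $M_n(\mathbb{C})$ is the space of $n\times n$ complex matrices, $\|\cdot\|$ is the operator norm, $I$ is the identity matrix, and $X\ge Y$ means that $X-Y$ is positive semidefinite. "Positive" means positive semidefinite (Hermitian), so a positive invertible matrix is a positive definite one. For positive invertible $X,Y\in M_n(\mathbb{C})$, the geometric mean is $X\sharp Y = X^{1/2}(X^{-1/2}YX^{-1/2})^{1/2}X^{1/2}$. For a unitary matrix $U$ with spectral decomposition $U=\sum_i z_iP_i$ (with $z_i\neq z_j$ for $i\ne j$, and $P_i$ the spectral projections), the map $E_U: M_n(\mathbb{C})\to M_n(\mathbb{C})$ is defined by $E_U(X)=\sum_i P_iXP_i$. *)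

theory Defs
  imports "HOL-Analysis.Analysis"
begin

definition conj_transpose :: "complex^'n^'n \<Rightarrow> complex^'n^'n" where
  "conj_transpose A = (\<chi> i j. cnj (A $ j $ i))"

definition hermitian_mat :: "complex^'n^'n \<Rightarrow> bool" where
  "hermitian_mat A \<longleftrightarrow> conj_transpose A = A"

definition normal_mat :: "complex^'n^'n \<Rightarrow> bool" where
  "normal_mat A \<longleftrightarrow> conj_transpose A ** A = A ** conj_transpose A"

definition unitary_mat :: "complex^'n^'n \<Rightarrow> bool" where
  "unitary_mat U \<longleftrightarrow> conj_transpose U ** U = mat 1 \<and> U ** conj_transpose U = mat 1"

text \<open>The quadratic form of a Hermitian matrix is real-valued, so requiring its real part to be
  nonnegative is the usual positivity.\<close>

definition psd :: "complex^'n^'n \<Rightarrow> bool" where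
  "psd A \<longleftrightarrow> hermitian_mat A \<and> (\<forall>v. 0 \<le> Re (\<Sum>i\<in>UNIV. cnj (v $ i) * (A *v v) $ i))"

definition loewner_ge :: "complex^'n^'n \<Rightarrow> complex^'n^'n \<Rightarrow> bool" where
  "loewner_ge X Y \<longleftrightarrow> psd (X - Y)"

definition pos_invertible :: "complex^'n^'n \<Rightarrow> bool" where
  "pos_invertible A \<longleftrightarrow> psd A \<and> invertible A"

text \<open>The norm on \<^typ>\<open>complex^'n\<close> is the Euclidean (Hermitian) norm, so this is the usual
  operator norm.\<close>

definition op_norm :: "complex^'n^'n \<Rightarrow> real" where
  "op_norm A = onorm (\<lambda>v. A *v v)"

text \<open>The unique positive semidefinite square root; only meaningful for positive
  semidefinite \<open>X\<close>.\<close>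

definition mat_sqrt :: "complex^'n^'n \<Rightarrow> complex^'n^'n" where
  "mat_sqrt X = (THE R. psd R \<and> R ** R = X)"

definition geom_mean :: "complex^'n^'n \<Rightarrow> complex^'n^'n \<Rightarrow> complex^'n^'n" where
  "geom_mean X Y =
     mat_sqrt X ** mat_sqrt (matrix_inv (mat_sqrt X) ** Y ** matrix_inv (mat_sqrt X)) ** mat_sqrt X"

definition eigenspace :: "complex^'n^'n \<Rightarrow> complex \<Rightarrow> (complex^'n) set" where
  "eigenspace U z = {v. U *v v = z *s v}"

definition spectrum :: "complex^'n^'n \<Rightarrow> complex set" where
  "spectrum U = {z. \<exists>v. v \<noteq> 0 \<and> U *v v = z *s v}"

text \<open>The orthogonal projection onto the eigenspace. For unitary (more generally normal) \<open>U\<close>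
  these are the projections of the spectral decomposition of \<open>U\<close>.\<close>

definition spectral_proj :: "complex^'n^'n \<Rightarrow> complex \<Rightarrow> complex^'n^'n" where
  "spectral_proj U z =
     (THE P. hermitian_mat P \<and> P ** P = P \<and> range (\<lambda>v. P *v v) = eigenspace U z)"

definition spectral_pinching :: "complex^'n^'n \<Rightarrow> complex^'n^'n \<Rightarrow> complex^'n^'n" where
  "spectral_pinching U X = (\<Sum>z\<in>spectrum U. spectral_proj U z ** X ** spectral_proj U z)"

end

theory Submission
  imports Defs
begin

text \<open>For positive definite \<open>S\<close> the geometric mean \<open>S \<sharp> T\<close> is the only positive solution \<open>G\<close> of
  \<open>G S\<^sup>-\<^sup>1 G = T\<close>, so \<open>(C\<^sup>* S C) \<sharp> (C\<^sup>* T C) = C\<^sup>* (S \<sharp> T) C\<close>. With the polar decomposition \<open>B = U D\<close>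
  (the factors commute because \<open>B\<close> is normal) and \<open>A = D\<^sup>1\<^sup>/\<^sup>2 S D\<^sup>1\<^sup>/\<^sup>2\<close>, the matrices whose norms are
  compared in (1) and (2) coincide up to a unitary factor. Assertion (3) for
  \<open>G = S \<sharp> (U\<^sup>* S\<^sup>-\<^sup>1 U)\<close> says that \<open>\<langle>e, G e\<rangle> \<ge> 1\<close> for every unit eigenvector \<open>e\<close> of \<open>U\<close>. Taking for
  \<open>e\<close> a common eigenvector of \<open>U\<close> and \<open>D\<close> with \<open>D e = \<parallel>D\<parallel> e\<close> gives (2); conversely, (2) for
  \<open>D = P + t\<^sup>2 (1 - P)\<close>, with \<open>P\<close> the projection onto the span of \<open>e\<close>, gives this bound as \<open>t \<rightarrow> 0\<close>.

  The inner product \<open>\<bullet>\<close> on \<^typ>\<open>complex^'n\<close> is the real part of the Hermitian one. The two have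
  the same adjoints, and the same orthogonal complements of complex subspaces.\<close>

section \<open>Adjoints and positivity through the real inner product\<close>

lemma inner_conj_transpose: "(A *v x) \<bullet> y = x \<bullet> (conj_transpose A *v y)"
  for A :: "complex^'n^'n"
proof -
  have *: "x \<bullet> y = Re (\<Sum>i\<in>UNIV. cnj (x $ i) * y $ i)" for x y :: "complex^'n"
    by (simp add: inner_vec_def inner_complex_def)
  have "(\<Sum>i\<in>UNIV. cnj ((A *v x) $ i) * y $ i)
      = (\<Sum>i\<in>UNIV. \<Sum>j\<in>UNIV. cnj (A $ i $ j) * cnj (x $ j) * y $ i)"
    by (simp add: matrix_vector_mult_def sum_distrib_right)
  also have "\<dots> = (\<Sum>j\<in>UNIV. \<Sum>i\<in>UNIV. cnj (A $ i $ j) * cnj (x $ j) * y $ i)"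
    by (rule sum.swap)
  also have "\<dots> = (\<Sum>j\<in>UNIV. cnj (x $ j) * (conj_transpose A *v y) $ j)"
    by (simp add: matrix_vector_mult_def conj_transpose_def sum_distrib_left mult_ac)
  finally show ?thesis by (simp add: *)
qed

lemma conj_transpose_conj_transpose [simp]: "conj_transpose (conj_transpose A) = A"
  by (simp add: conj_transpose_def vec_eq_iff)

lemma inner_conj_transpose': "(conj_transpose A *v x) \<bullet> y = x \<bullet> (A *v y)"
  by (simp add: inner_conj_transpose)

lemma conj_transpose_mult: "conj_transpose (A ** B) = conj_transpose B ** conj_transpose A"
  by (simp add: conj_transpose_def matrix_matrix_mult_def vec_eq_iff mult.commute)

lemma conj_transpose_mat_1 [simp]: "conj_transpose (mat 1) = mat 1"
  by (simp add: conj_transpose_def mat_def vec_eq_iff)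

lemma conj_transpose_diff: "conj_transpose (A - B) = conj_transpose A - conj_transpose B"
  by (simp add: conj_transpose_def vec_eq_iff)

lemma conj_transpose_unique:
  assumes "\<And>x y. (A *v x) \<bullet> y = x \<bullet> (B *v y)"
  shows "conj_transpose A = B"
proof -
  have "conj_transpose A *v y = B *v y" for y
  proof (rule vector_eq_ldot[THEN iffD1, rule_format])
    show "x \<bullet> (conj_transpose A *v y) = x \<bullet> (B *v y)" for x
      by (metis assms inner_conj_transpose)
  qed
  then show ?thesis by (simp add: matrix_eq)
qed

lemma hermitian_iff: "hermitian_mat A \<longleftrightarrow> (\<forall>x y. (A *v x) \<bullet> y = x \<bullet> (A *v y))"
  by (metis conj_transpose_unique hermitian_mat_def inner_conj_transpose)

lemma hermitianD: "hermitian_mat A \<Longrightarrow> (A *v x) \<bullet> y = x \<bullet> (A *v y)"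
  by (simp add: hermitian_iff)

lemma psd_iff: "psd A \<longleftrightarrow> hermitian_mat A \<and> (\<forall>v. 0 \<le> v \<bullet> (A *v v))"
  by (simp add: psd_def inner_vec_def inner_complex_def)

lemma psd_hermitian: "psd A \<Longrightarrow> hermitian_mat A"
  by (simp add: psd_def)

lemma psd_nonneg: "psd A \<Longrightarrow> 0 \<le> v \<bullet> (A *v v)"
  by (simp add: psd_iff)

lemma psd_congruence: "psd A \<Longrightarrow> psd (conj_transpose C ** A ** C)"
  unfolding psd_iff hermitian_mat_def
  by (simp add: conj_transpose_mult matrix_mul_assoc flip: matrix_vector_mul_assoc inner_conj_transpose)

lemma psd_mat_1: "psd (mat 1)"
  by (simp add: psd_iff hermitian_mat_def)

lemma psd_conj_transpose_mult: "psd (conj_transpose B ** B)"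
  using psd_congruence[OF psd_mat_1, of B] by simp

lemma inner_smult: "(c *s x) \<bullet> y = x \<bullet> (cnj c *s y)" for x y :: "complex^'n"
  by (simp add: inner_vec_def inner_complex_def algebra_simps)

lemma inner_smult_smult: "(c *s x) \<bullet> (c *s y) = (cmod c)\<^sup>2 * (x \<bullet> y)" for x y :: "complex^'n"
proof -
  have "cnj c * c = of_real ((cmod c)\<^sup>2)"
    by (metis complex_norm_square mult.commute)
  moreover have "cnj c *s (c *s y) = (cnj c * c) *s y"
    by (simp add: vector_smult_assoc)
  ultimately have "cnj c *s (c *s y) = (cmod c)\<^sup>2 *\<^sub>R y"
    by (simp add: vec_eq_iff scaleR_conv_of_real[where 'a = complex])
  then show ?thesis by (simp add: inner_smult)
qed

lemma scaleR_eq_smult: "r *\<^sub>R x = of_real r *s x" for x :: "complex^'n"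
  by (simp add: vec_eq_iff scaleR_conv_of_real[where 'a = complex])

lemma matrix_vector_scaleR: "A *v (r *\<^sub>R x) = r *\<^sub>R (A *v x)" for A :: "complex^'n^'n"
  by (simp add: scaleR_eq_smult vector_scalar_commute)

lemma scaleR_matrix_vector: "(r *\<^sub>R A) *v x = r *\<^sub>R (A *v x)" for A :: "complex^'n^'n"
  by (simp add: matrix_vector_mult_def vec_eq_iff scaleR_right.sum)

lemma subspace_of_vec_subspace: "vec.subspace W \<Longrightarrow> subspace W" for W :: "(complex^'n) set"
  by (auto simp: vec.subspace_def subspace_def scaleR_eq_smult)

section \<open>Eigenvectors\<close>

text \<open>The nonnegative quadratic \<open>t \<mapsto> q(v + t M v)\<close> vanishes at 0, hence so does its derivative
  \<open>2 |M v|\<^sup>2\<close>.\<close>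

lemma hermitian_form_zero:
  fixes M :: "complex^'n^'n"
  assumes M: "hermitian_mat M" and W: "subspace W" "\<And>w. w \<in> W \<Longrightarrow> M *v w \<in> W"
    and pos: "\<And>w. w \<in> W \<Longrightarrow> 0 \<le> w \<bullet> (M *v w)"
    and v: "v \<in> W" "v \<bullet> (M *v v) = 0"
  shows "M *v v = 0"
proof (rule ccontr)
  define w where "w = M *v v"
  assume "M *v v \<noteq> 0"
  then have a: "0 < w \<bullet> w" by (simp add: w_def)
  have wW: "w \<in> W" using v W by (simp add: w_def)
  define b where "b = w \<bullet> (M *v w)"
  have b: "0 \<le> b" using pos wW by (simp add: b_def)
  \<comment> \<open>The quadratic in \<open>t\<close> is minimal at
    \<open>- (w \<bullet> w) / b\<close>. The denominator \<open>b + 1\<close> stays positive for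
    \<open>b = 0\<close> and still gives a negative value, namely
    \<open>t * (w \<bullet> w) - t\<^sup>2\<close>.\<close>
  define t where "t = - (w \<bullet> w) / (b + 1)"
  have "v + t *\<^sub>R w \<in> W" using W(1) v wW by (simp add: subspace_add subspace_scale)
  then have "0 \<le> (v + t *\<^sub>R w) \<bullet> (M *v (v + t *\<^sub>R w))" by (rule pos)
  also have "\<dots> = 2 * t * (w \<bullet> w) + t\<^sup>2 * b"
    using v(2) hermitianD[OF M, of v w]
    by (simp add: matrix_vector_right_distrib matrix_vector_scaleR inner_add_left inner_add_right
        b_def algebra_simps power2_eq_square flip: w_def)
  finally have "0 \<le> 2 * t * (w \<bullet> w) + t\<^sup>2 * b" .
  moreover have "t * (b + 1) = - (w \<bullet> w)" using b by (simp add: t_def)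
  then have "t * (t * (b + 1)) = - t * (w \<bullet> w)" by simp
  then have "t\<^sup>2 * b = - t * (w \<bullet> w) - t\<^sup>2"
    by (simp add: power2_eq_square distrib_left)
  moreover have "t < 0" using a b by (simp add: t_def divide_neg_pos)
  then have "t * (w \<bullet> w) < 0" using a by (rule mult_neg_pos)
  ultimately show False using zero_le_power2[of t] by linarith
qed

lemma psd_form_zero: "psd M \<Longrightarrow> v \<bullet> (M *v v) = 0 \<Longrightarrow> M *v v = 0"
  by (rule hermitian_form_zero[where W = UNIV]) (auto simp: psd_iff)

text \<open>Maximise the Rayleigh quotient over the compact unit sphere of \<open>W\<close>. If the
  maximum \<open>l\<close> is attained at \<open>v\<close>, the form of \<open>l - H\<close> is
  nonnegative on \<open>W\<close> and vanishes at \<open>v\<close>, so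
  \<open>hermitian_form_zero\<close> makes \<open>v\<close> an eigenvector. \<open>W\<close> is a
  real subspace, so real eigenspaces may be inserted for it.\<close>

lemma hermitian_max_eigenvector:
  fixes H :: "complex^'n^'n"
  assumes H: "hermitian_mat H" and W: "subspace W" "\<And>w. w \<in> W \<Longrightarrow> H *v w \<in> W"
    and x: "x \<in> W" "x \<noteq> 0"
  obtains v l where "v \<in> W" "norm v = 1" "H *v v = l *\<^sub>R v"
    "\<And>w. w \<in> W \<Longrightarrow> w \<bullet> (H *v w) \<le> l * (w \<bullet> w)"
proof -
  let ?S = "sphere 0 1 \<inter> W"
  have "compact ?S" using closed_subspace[OF W(1)] by (simp add: compact_Int_closed)
  moreover have "(1 / norm x) *\<^sub>R x \<in> ?S" using x W(1) by (simp add: subspace_scale)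
  moreover have "continuous_on ?S (\<lambda>w. w \<bullet> (H *v w))"
    by (intro continuous_intros linear_continuous_on matrix_vector_mul_bounded_linear)
  ultimately have "\<exists>v\<in>?S. \<forall>w\<in>?S. w \<bullet> (H *v w) \<le> v \<bullet> (H *v v)"
    by (intro continuous_attains_sup) blast+
  then obtain v where v: "v \<in> ?S" and max: "\<forall>w\<in>?S. w \<bullet> (H *v w) \<le> v \<bullet> (H *v v)"
    by blast
  define l where "l = v \<bullet> (H *v v)"
  have le: "w \<bullet> (H *v w) \<le> l * (w \<bullet> w)" if w: "w \<in> W" for w
  proof (cases "w = 0")
    case False
    then have "(1 / norm w) *\<^sub>R w \<in> ?S" using w W(1) by (simp add: subspace_scale)
    then have "(1 / norm w) *\<^sub>R w \<bullet> (H *v ((1 / norm w) *\<^sub>R w)) \<le> l"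
      using max l_def by blast
    then have "(w \<bullet> (H *v w)) / (norm w)\<^sup>2 \<le> l"
      by (simp add: matrix_vector_scaleR power2_eq_square)
    then show ?thesis using False by (simp add: divide_le_eq dot_square_norm)
  qed simp
  define M where "M = l *\<^sub>R mat 1 - H"
  have Mv: "M *v w = l *\<^sub>R w - H *v w" for w
    by (simp add: M_def matrix_vector_mult_diff_rdistrib scaleR_matrix_vector)
  have "M *v v = 0"
  proof (rule hermitian_form_zero[OF _ W(1)])
    show "hermitian_mat M"
      using hermitianD[OF H] by (simp add: hermitian_iff Mv inner_diff_left inner_diff_right)
    show "M *v w \<in> W" if "w \<in> W" for w
      using that W by (simp add: Mv subspace_diff subspace_scale)
    show "0 \<le> w \<bullet> (M *v w)" if "w \<in> W" for w
      using le[OF that] by (simp add: Mv inner_diff_right)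
    show "v \<bullet> (M *v v) = 0"
      using v by (simp add: Mv inner_diff_right l_def dot_square_norm)
  qed (use v in auto)
  then have "H *v v = l *\<^sub>R v" by (simp add: Mv)
  then show ?thesis using that v le by auto
qed

text \<open>Diagonalise the commuting Hermitian matrices \<open>N + N\<^sup>*\<close> and \<open>i (N\<^sup>* - N)\<close> one after the
  other.\<close>

lemma normal_eigenvector:
  fixes N :: "complex^'n^'n"
  assumes N: "normal_mat N" and W: "vec.subspace W" "\<And>w. w \<in> W \<Longrightarrow> N *v w \<in> W"
      "\<And>w. w \<in> W \<Longrightarrow> conj_transpose N *v w \<in> W"
    and x: "x \<in> W" "x \<noteq> 0"
  obtains v z where "v \<in> W" "norm v = 1" "N *v v = z *s v"
proof -
  let ?N' = "conj_transpose N"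
  have comm: "N *v (?N' *v w) = ?N' *v (N *v w)" for w
    using N by (simp add: normal_mat_def matrix_vector_mul_assoc)
  define H where "H = N + ?N'"
  define K where "K = matrix (\<lambda>w. \<i> *s (?N' *v w - N *v w))"
  have Hv: "H *v w = N *v w + ?N' *v w" for w
    by (simp add: H_def matrix_vector_mult_add_rdistrib)
  have "Vector_Spaces.linear (*s) (*s) (\<lambda>w. \<i> *s (?N' *v w - N *v w))"
    by unfold_locales (simp_all add: algebra_simps vector_scalar_commute vector_add_ldistrib
        vector_ssub_ldistrib vector_smult_assoc)
  then have Kv: "K *v w = \<i> *s (?N' *v w - N *v w)" for w
    by (simp add: K_def matrix_works)
  have H: "hermitian_mat H"
    by (simp add: hermitian_iff Hv inner_add_left inner_add_right inner_conj_transpose)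
  have K: "hermitian_mat K"
    by (simp add: hermitian_iff Kv inner_smult inner_diff_left inner_diff_right
        inner_conj_transpose vector_scalar_commute vector_ssub_ldistrib vector_smult_lneg)
  \<comment> \<open>Normality makes \<open>H\<close> and \<open>K\<close> commute, so
    \<open>K\<close> maps the eigenspace \<open>V\<close> of \<open>H\<close> into itself.\<close>
  have KH: "K *v (H *v w) = H *v (K *v w)" for w
    by (simp add: Kv Hv comm vector_scalar_commute matrix_vector_right_distrib
        matrix_vector_mult_diff_distrib vector_add_ldistrib vector_ssub_ldistrib)
  have HW: "H *v w \<in> W" if "w \<in> W" for w
    using that W by (simp add: Hv vec.subspace_add)
  have KW: "K *v w \<in> W" if "w \<in> W" for w
    using that W by (simp add: Kv vec.subspace_diff vec.subspace_scale)
  obtain u a where u: "u \<in> W" "norm u = 1" "H *v u = a *\<^sub>R u"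
    using hermitian_max_eigenvector[OF H subspace_of_vec_subspace[OF W(1)] HW x] by metis
  define V where "V = {w \<in> W. H *v w = a *\<^sub>R w}"
  have V: "subspace V"
    using subspace_of_vec_subspace[OF W(1)]
    by (auto simp: V_def subspace_def matrix_vector_right_distrib matrix_vector_scaleR algebra_simps)
  have KV: "K *v w \<in> V" if "w \<in> V" for w
    using that KW by (simp add: V_def matrix_vector_scaleR flip: KH)
  have "u \<in> V" "u \<noteq> 0" using u by (auto simp: V_def)
  then obtain v b where v: "v \<in> V" "norm v = 1" "K *v v = b *\<^sub>R v"
    using hermitian_max_eigenvector[OF K V KV] by metis
  \<comment> \<open>Since \<open>2 N = H + i K\<close>, the common eigenvector \<open>v\<close> has
    eigenvalue \<open>(a + i b) / 2\<close> under \<open>N\<close>.\<close>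
  have "N *v v + ?N' *v v = a *\<^sub>R v" using v by (simp add: V_def Hv)
  moreover have "?N' *v v - N *v v = (- \<i> * of_real b) *s v"
  proof -
    have "?N' *v v - N *v v = (- \<i>) *s (K *v v)" by (simp add: Kv vector_smult_assoc)
    then show ?thesis by (simp add: v scaleR_eq_smult vector_smult_assoc)
  qed
  ultimately have "(N *v v + ?N' *v v) - (?N' *v v - N *v v)
      = of_real a *s v - (- \<i> * of_real b) *s v"
    by (simp only: scaleR_eq_smult)
  then have "2 *s (N *v v) = (of_real a + \<i> * of_real b) *s v"
    by (simp add: vec_eq_iff ring_distribs)
  then have "(1/2) *s (2 *s (N *v v)) = (1/2) *s ((of_real a + \<i> * of_real b) *s v)"
    by simp
  then have "N *v v = ((1/2) * (of_real a + \<i> * of_real b)) *s v"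
    by (simp add: vector_smult_assoc vector_sadd_rdistrib add_divide_distrib)
  then show ?thesis using that v by (auto simp: V_def)
qed

text \<open>Factor \<open>R R - s\<^sup>2 = (R + s) (R - s)\<close>: the vector
  \<open>w = (R - s) v\<close> satisfies \<open>R w = - s w\<close>, and a positive matrix has no
  negative eigenvalue.\<close>

lemma psd_eigenvector_of_square:
  assumes R: "psd R" and eq: "R *v (R *v v) = s\<^sup>2 *\<^sub>R v" and s: "0 < s"
  shows "R *v v = s *\<^sub>R v"
proof -
  define w where "w = R *v v - s *\<^sub>R v"
  have "R *v w = - s *\<^sub>R w"
    by (simp add: w_def matrix_vector_mult_diff_distrib matrix_vector_scaleR eq
        power2_eq_square scaleR_diff_right)
  then have "0 \<le> - s * (w \<bullet> w)" using psd_nonneg[OF R, of w] by simp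
  then have "w \<bullet> w \<le> 0" using s by (simp add: mult_le_0_iff)
  then have "w = 0" by (metis inner_eq_zero_iff inner_ge_zero order_antisym)
  then show ?thesis by (simp add: w_def)
qed

section \<open>The operator norm of positive matrices\<close>

lemma norm_le_op_norm: "norm (M *v v) \<le> op_norm M * norm v" for M :: "complex^'n^'n"
  unfolding op_norm_def by (rule onorm) (rule matrix_vector_mul_bounded_linear)

lemma inner_le_op_norm: "v \<bullet> (M *v v) \<le> op_norm M * (v \<bullet> v)" for M :: "complex^'n^'n"
proof -
  have "v \<bullet> (M *v v) \<le> norm v * norm (M *v v)" by (rule norm_cauchy_schwarz)
  also have "\<dots> \<le> norm v * (op_norm M * norm v)"
    by (intro mult_left_mono norm_le_op_norm) simp
  finally show ?thesis by (simp add: dot_square_norm power2_eq_square mult_ac)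
qed

text \<open>The form of \<open>M ** M\<close> at \<open>w\<close> is the square of the norm of
  \<open>M w\<close>, so the largest eigenvalue of \<open>M ** M\<close> is the square of the
  operator norm. Positivity of \<open>M\<close> then turns a top eigenvector of
  \<open>M ** M\<close> into one of \<open>M\<close>, by
  \<open>psd_eigenvector_of_square\<close>.\<close>

lemma psd_norm_eigenvector:
  fixes M :: "complex^'n^'n"
  assumes M: "psd M"
  obtains v where "norm v = 1" "M *v v = op_norm M *\<^sub>R v"
proof -
  have herm: "(M *v x) \<bullet> y = x \<bullet> (M *v y)" for x y
    by (rule hermitianD[OF psd_hermitian[OF M]])
  have "hermitian_mat (M ** M)"
    by (simp add: hermitian_iff herm flip: matrix_vector_mul_assoc)
  moreover obtain x :: "complex^'n" where "norm x = 1" by (rule vector_choose_size[of 1]) simp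
  then have "x \<noteq> 0" by auto
  ultimately obtain v l where v: "norm v = 1" "(M ** M) *v v = l *\<^sub>R v"
    and max: "\<And>w. w \<bullet> ((M ** M) *v w) \<le> l * (w \<bullet> w)"
    using hermitian_max_eigenvector[of "M ** M" UNIV x] by auto
  have sq: "w \<bullet> ((M ** M) *v w) = (norm (M *v w))\<^sup>2" for w
    by (simp add: herm dot_square_norm[symmetric] flip: matrix_vector_mul_assoc)
  have l: "l = (norm (M *v v))\<^sup>2"
    using v by (simp flip: sq) (simp add: dot_square_norm)
  have "op_norm M = norm (M *v v)"
  proof (rule antisym)
    show "op_norm M \<le> norm (M *v v)"
      unfolding op_norm_def
    proof (rule onorm_bound)
      fix w
      have "(norm (M *v w))\<^sup>2 \<le> (norm (M *v v) * norm w)\<^sup>2"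
        using max[of w] by (simp add: sq l dot_square_norm power_mult_distrib)
      then show "norm (M *v w) \<le> norm (M *v v) * norm w"
        by (rule power2_le_imp_le) simp
    qed simp
    show "norm (M *v v) \<le> op_norm M" using norm_le_op_norm[of M v] v by simp
  qed
  moreover have "M *v v = norm (M *v v) *\<^sub>R v"
  proof (cases "M *v v = 0")
    case False
    then show ?thesis
      using psd_eigenvector_of_square[OF M, of v "norm (M *v v)"] v l
      by (simp add: matrix_vector_mul_assoc)
  qed simp
  ultimately show ?thesis using that v by metis
qed

section \<open>Spectral decomposition of normal matrices\<close>

lemma matrix_vector_sum: "(\<Sum>i\<in>I. A i) *v x = (\<Sum>i\<in>I. A i *v x)"
  for A :: "'i \<Rightarrow> complex^'n^'n"
  by (induction I rule: infinite_finite_induct) (simp_all add: matrix_vector_mult_add_rdistrib)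

lemma matrix_vector_sum_right: "A *v (\<Sum>i\<in>I. f i) = (\<Sum>i\<in>I. A *v f i)"
  for A :: "complex^'n^'n"
  by (induction I rule: infinite_finite_induct) (simp_all add: matrix_vector_right_distrib)

text \<open>The real orthogonal projection \<open>p\<close> sends \<open>x\<close> to the only
  \<open>y\<close> in \<open>W\<close> with \<open>x - y\<close> orthogonal to \<open>W\<close>. As
  \<open>W\<close> is a complex subspace, this characterisation is respected by complex scalars, so
  \<open>p\<close> is given by a complex matrix.\<close>

lemma orth_projection_exists:
  fixes W :: "(complex^'n) set"
  assumes W: "vec.subspace W"
  shows "\<exists>P. hermitian_mat P \<and> P ** P = P \<and> range (\<lambda>v. P *v v) = W"
proof -
  have "\<exists>y\<in>W. \<forall>w\<in>W. (x - y) \<bullet> w = 0" for x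
  proof -
    have span: "span W = W" using W by (simp add: span_eq_iff subspace_of_vec_subspace)
    obtain y z where "y \<in> span W" "\<And>w. w \<in> span W \<Longrightarrow> orthogonal z w" "x = y + z"
      using orthogonal_subspace_decomp_exists[of W x] by blast
    then show ?thesis unfolding span
      by (intro bexI[of _ y]) (auto simp: orthogonal_def)
  qed
  then obtain p where p: "\<And>x. p x \<in> W" "\<And>x w. w \<in> W \<Longrightarrow> (x - p x) \<bullet> w = 0" by metis
  have uniq: "p x = y" if "y \<in> W" "\<And>w. w \<in> W \<Longrightarrow> (x - y) \<bullet> w = 0" for x y
  proof -
    have *: "p x - y \<in> W" using W p that by (simp add: vec.subspace_diff)
    have "(p x - y) \<bullet> (p x - y) = (x - y) \<bullet> (p x - y) - (x - p x) \<bullet> (p x - y)"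
      by (simp flip: inner_diff_left)
    also have "\<dots> = 0" using that p * by simp
    finally show ?thesis by simp
  qed
  have "Vector_Spaces.linear (*s) (*s) p"
  proof unfold_locales
    fix x y c
    show "p (x + y) = p x + p y"
    proof (rule uniq)
      show "(x + y - (p x + p y)) \<bullet> w = 0" if "w \<in> W" for w
        using p(2)[OF that, of x] p(2)[OF that, of y]
        by (simp add: inner_add_left inner_diff_left)
    qed (use W p in \<open>simp add: vec.subspace_add\<close>)
    \<comment> \<open>The scalar \<open>c\<close> crosses the real inner product as
      \<open>cnj c\<close>, and \<open>cnj c *s w\<close> stays in \<open>W\<close>.\<close>
    show "p (c *s x) = c *s p x"
    proof (rule uniq)
      show "(c *s x - c *s p x) \<bullet> w = 0" if "w \<in> W" for w
        using p(2)[of "cnj c *s w" x] that W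
        by (simp add: inner_smult vec.subspace_scale flip: vector_ssub_ldistrib)
    qed (use W p in \<open>simp add: vec.subspace_scale\<close>)
  qed
  then have P: "matrix p *v x = p x" for x by (rule matrix_works)
  have p_fix: "p w = w" if "w \<in> W" for w by (rule uniq) (use that in auto)
  have 1: "p x \<bullet> y = p x \<bullet> p y" for x y
    using p(2)[of "p x" y] p(1) by (simp add: inner_diff_left inner_commute[of "p x"])
  have "hermitian_mat (matrix p)"
    unfolding hermitian_iff P by (metis 1 inner_commute)
  moreover have "matrix p ** matrix p = matrix p"
    by (simp add: matrix_eq P p_fix p flip: matrix_vector_mul_assoc)
  moreover have "range (\<lambda>v. matrix p *v v) = W"
    unfolding P using p p_fix by (metis image_subset_iff rangeI subsetI subset_antisym)
  ultimately show ?thesis by blast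
qed

text \<open>Each projection fixes the common range, so \<open>P Q = Q\<close> and
  \<open>Q P = P\<close>. The adjoint of the first equation is \<open>Q P = Q\<close>.\<close>

lemma orth_projection_unique:
  assumes P: "hermitian_mat P" "P ** P = P" and Q: "hermitian_mat Q" "Q ** Q = Q"
    and range: "range (\<lambda>v. P *v v) = range (\<lambda>v. Q *v v)"
  shows "P = Q"
proof -
  have "P ** Q = Q"
    unfolding matrix_eq by (metis P(2) matrix_vector_mul_assoc range rangeE rangeI)
  moreover have "Q ** P = P"
    unfolding matrix_eq by (metis Q(2) matrix_vector_mul_assoc range rangeE rangeI)
  ultimately show ?thesis
    by (metis P(1) Q(1) conj_transpose_mult hermitian_mat_def)
qed

section \<open>Spectral projections\<close>

lemma vec_subspace_eigenspace: "vec.subspace (eigenspace N z)"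
  by (auto simp: vec.subspace_def eigenspace_def matrix_vector_right_distrib vector_add_ldistrib
      vector_scalar_commute vector_smult_assoc mult.commute)

text \<open>Existence and uniqueness of the orthogonal projection onto a complex subspace justify
  the definite description. If \<open>z\<close> is no eigenvalue, the projection is 0.\<close>

lemma spectral_proj_props:
  "hermitian_mat (spectral_proj N z) \<and> spectral_proj N z ** spectral_proj N z = spectral_proj N z \<and>
   range (\<lambda>v. spectral_proj N z *v v) = eigenspace N z"
  unfolding spectral_proj_def
proof (rule theI')
  show "\<exists>!P. hermitian_mat P \<and> P ** P = P \<and> range (\<lambda>v. P *v v) = eigenspace N z"
    using orth_projection_exists[OF vec_subspace_eigenspace[of N z]]
    by (metis orth_projection_unique)
qed

lemma spectral_proj_hermitian: "(spectral_proj N z *v x) \<bullet> y = x \<bullet> (spectral_proj N z *v y)"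
  using spectral_proj_props by (blast intro: hermitianD)

lemma spectral_proj_idem: "spectral_proj N z *v (spectral_proj N z *v x) = spectral_proj N z *v x"
  by (simp add: matrix_vector_mul_assoc spectral_proj_props)

lemma spectral_proj_eigen: "N *v (spectral_proj N z *v x) = z *s (spectral_proj N z *v x)"
  using spectral_proj_props[of N z] by (auto simp: eigenspace_def)

lemma spectral_proj_fix:
  assumes "N *v e = z *s e"
  shows "spectral_proj N z *v e = e"
proof -
  have "e \<in> range (\<lambda>v. spectral_proj N z *v v)"
    using assms by (simp add: spectral_proj_props eigenspace_def)
  then show ?thesis using spectral_proj_idem by auto
qed

text \<open>By normality the adjoint of \<open>N\<close> and \<open>N\<close> itself map
  \<open>v\<close> to vectors of equal length. Expanding the squared length of
  \<open>?a - ?b\<close> therefore gives 0.\<close>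

lemma normal_adjoint_eigenvector:
  assumes N: "normal_mat N" and v: "N *v v = z *s v"
  shows "conj_transpose N *v v = cnj z *s v"
proof -
  let ?a = "conj_transpose N *v v" and ?b = "cnj z *s v"
  have zz: "v \<bullet> (z *s (cnj z *s v)) = (cmod z)\<^sup>2 * (v \<bullet> v)"
    using inner_smult_smult[of "cnj z" v v] by (simp add: inner_smult)
  have "?a \<bullet> ?a = v \<bullet> ((conj_transpose N ** N) *v v)"
    using N by (simp add: inner_conj_transpose' normal_mat_def matrix_vector_mul_assoc)
  also have "\<dots> = (N *v v) \<bullet> (N *v v)"
    by (simp add: inner_conj_transpose flip: matrix_vector_mul_assoc)
  finally have "?a \<bullet> ?a = (cmod z)\<^sup>2 * (v \<bullet> v)" by (simp add: v inner_smult_smult)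
  moreover have "?a \<bullet> ?b = (cmod z)\<^sup>2 * (v \<bullet> v)"
    using zz by (simp add: inner_conj_transpose' vector_scalar_commute v vector_smult_assoc mult.commute)
  moreover have "?b \<bullet> ?b = (cmod z)\<^sup>2 * (v \<bullet> v)" by (simp add: inner_smult_smult)
  ultimately have "(?a - ?b) \<bullet> (?a - ?b) = 0"
    by (simp add: inner_diff_left inner_diff_right inner_commute)
  then show ?thesis by simp
qed

lemma normal_eigenvectors_orthogonal:
  assumes N: "normal_mat N" and v: "N *v v = z *s v" and w: "N *v w = y *s w" and "z \<noteq> y"
  shows "v \<bullet> w = 0"
proof -
  \<comment> \<open>Rescaling in advance absorbs the complex factor \<open>z - y\<close>, which
    cannot be pulled out of a real inner product.\<close>
  define u where "u = (1 / (z - y)) *s v"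
  have "N *v u = z *s u"
    by (simp add: u_def vector_scalar_commute v vector_smult_assoc)
  then have "(z *s u) \<bullet> w = u \<bullet> (cnj y *s w)"
    using normal_adjoint_eigenvector[OF N w] by (metis inner_conj_transpose)
  then have "((z - y) *s u) \<bullet> w = 0"
    by (simp add: inner_smult vector_sub_rdistrib inner_diff_left)
  then show ?thesis using \<open>z \<noteq> y\<close> by (simp add: u_def vector_smult_assoc)
qed

lemma spectral_proj_other:
  assumes N: "normal_mat N" and e: "N *v e = z *s e" and "z \<noteq> y"
  shows "spectral_proj N y *v e = 0"
proof -
  have "e \<bullet> (spectral_proj N y *v e) = 0"
    using normal_eigenvectors_orthogonal[OF N e spectral_proj_eigen \<open>z \<noteq> y\<close>] .
  then have "(spectral_proj N y *v e) \<bullet> (spectral_proj N y *v e) = 0"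
    by (simp add: spectral_proj_hermitian spectral_proj_idem)
  then show ?thesis by simp
qed

text \<open>One eigenvector chosen for each eigenvalue gives an orthogonal, hence independent,
  family, and independent sets are finite here.\<close>

lemma finite_spectrum:
  assumes N: "normal_mat N"
  shows "finite (spectrum N)"
proof -
  have "\<forall>z\<in>spectrum N. \<exists>v. v \<noteq> 0 \<and> N *v v = z *s v"
    by (simp add: spectrum_def)
  then obtain e where e: "\<And>z. z \<in> spectrum N \<Longrightarrow> e z \<noteq> 0 \<and> N *v e z = z *s e z"
    by metis
  have orth: "e z \<bullet> e y = 0" if "z \<in> spectrum N" "y \<in> spectrum N" "z \<noteq> y" for z y
    using normal_eigenvectors_orthogonal[OF N] e that by blast
  have "pairwise orthogonal (e ` spectrum N)"
    using orth by (auto simp: pairwise_def orthogonal_def)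
  then have "independent (e ` spectrum N)"
    using e by (intro pairwise_orthogonal_independent) auto
  then have "finite (e ` spectrum N)" by (rule independent_imp_finite)
  moreover have "inj_on e (spectrum N)"
    using orth e by (metis inj_onI inner_eq_zero_iff)
  ultimately show ?thesis by (rule finite_imageD)
qed

text \<open>Functional calculus on eigenvectors: only the summand at \<open>z\<close> survives. The
  constant function 1 serves the spectral decomposition, the square root serves
  \<open>psd_sqrt_exists\<close>. For \<open>e = 0\<close>, where \<open>z\<close> may lie outside
  the spectrum, both sides vanish.\<close>

lemma sum_spectral_proj_eigenvector:
  fixes f :: "complex \<Rightarrow> real"
  assumes N: "normal_mat N" and e: "N *v e = z *s e"
  shows "(\<Sum>y\<in>spectrum N. f y *\<^sub>R (spectral_proj N y *v e)) = f z *\<^sub>R e"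
proof (cases "e = 0")
  case False
  then have z: "z \<in> spectrum N" using e by (auto simp: spectrum_def)
  have "(\<Sum>y\<in>spectrum N. f y *\<^sub>R (spectral_proj N y *v e))
      = (\<Sum>y\<in>spectrum N. if y = z then f z *\<^sub>R e else 0)"
    by (rule sum.cong) (auto simp: spectral_proj_fix[OF e] spectral_proj_other[OF N e])
  then show ?thesis using z finite_spectrum[OF N] by simp
qed simp

text \<open>The orthogonal complement of all eigenvectors is invariant under \<open>N\<close> and \<open>N\<^sup>*\<close> but contains
  no eigenvector, so it is trivial.\<close>

lemma spectral_decomposition:
  assumes N: "normal_mat N"
  shows "(\<Sum>z\<in>spectrum N. spectral_proj N z *v x) = x"
proof -
  define W where "W = {x. \<forall>z e. N *v e = z *s e \<longrightarrow> x \<bullet> e = 0}"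
  have NW: "N *v w \<in> W" if w: "w \<in> W" for w
    unfolding W_def
  proof (clarify)
    fix z e assume e: "N *v e = z *s e"
    \<comment> \<open>Moving \<open>N\<close> to the other side turns \<open>e\<close> into
      \<open>cnj z *s e\<close>, again an eigenvector and so orthogonal to \<open>w\<close>.\<close>
    have "N *v (cnj z *s e) = z *s (cnj z *s e)"
      by (simp add: vector_scalar_commute e vector_smult_assoc mult.commute)
    then show "(N *v w) \<bullet> e = 0"
      using w unfolding W_def mem_Collect_eq inner_conj_transpose
        normal_adjoint_eigenvector[OF N e] by blast
  qed
  have NW': "conj_transpose N *v w \<in> W" if w: "w \<in> W" for w
    unfolding W_def
  proof (clarify)
    fix z e assume e: "N *v e = z *s e"
    then have "N *v (z *s e) = z *s (z *s e)" by (simp add: vector_scalar_commute)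
    then show "(conj_transpose N *v w) \<bullet> e = 0"
      using w unfolding W_def mem_Collect_eq inner_conj_transpose' e by blast
  qed
  \<comment> \<open>Although \<open>W\<close> is defined by a real inner product, it is closed under
    complex scalars, because complex multiples of eigenvectors are again eigenvectors.\<close>
  have W: "vec.subspace W"
    unfolding vec.subspace_def
  proof (intro conjI ballI allI)
    show "c *s w \<in> W" if w: "w \<in> W" for c w
      unfolding W_def
    proof (clarify)
      fix z e assume "N *v e = z *s e"
      then have "N *v (cnj c *s e) = z *s (cnj c *s e)"
        by (simp add: vector_scalar_commute vector_smult_assoc mult.commute)
      then show "(c *s w) \<bullet> e = 0" using w unfolding W_def mem_Collect_eq inner_smult by blast
    qed
    show "x + y \<in> W" if "x \<in> W" "y \<in> W" for x y
      using that unfolding W_def mem_Collect_eq inner_add_left by (metis add_0)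
  qed (simp add: W_def)
  have W0: "w = 0" if w: "w \<in> W" for w
  proof (rule ccontr)
    assume "w \<noteq> 0"
    then obtain v z where v: "v \<in> W" "norm v = 1" "N *v v = z *s v"
      using normal_eigenvector[OF N W NW NW' w] by metis
    then have "v \<bullet> v = 0" unfolding W_def by blast
    then show False using v by simp
  qed
  \<comment> \<open>The sum of the projections is self-adjoint and fixes every eigenvector, so the
    remainder \<open>y\<close> is orthogonal to all of them.\<close>
  define y where "y = x - (\<Sum>z\<in>spectrum N. spectral_proj N z *v x)"
  have "y \<in> W"
    unfolding W_def
  proof (clarify)
    fix z e assume e: "N *v e = z *s e"
    have "(\<Sum>y\<in>spectrum N. spectral_proj N y *v x) \<bullet> e
        = x \<bullet> (\<Sum>y\<in>spectrum N. spectral_proj N y *v e)"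
      by (simp add: inner_sum_left inner_sum_right spectral_proj_hermitian)
    also have "\<dots> = x \<bullet> e"
      using sum_spectral_proj_eigenvector[OF N e, of "\<lambda>_. 1"] by simp
    finally show "y \<bullet> e = 0" by (simp add: y_def inner_diff_left)
  qed
  then have "y = 0" by (rule W0)
  then show ?thesis by (simp add: y_def)
qed

section \<open>Square roots and geometric means\<close>

lemma hermitian_normal: "hermitian_mat A \<Longrightarrow> normal_mat A"
  by (simp add: hermitian_mat_def normal_mat_def)

lemma psd_eigenvalue:
  assumes X: "psd X" and e: "X *v e = z *s e" "e \<noteq> 0"
  shows "z = of_real (Re z)" and "0 \<le> Re z"
proof -
  have "cnj z *s e = z *s e"
    using normal_adjoint_eigenvector[OF hermitian_normal e(1)] psd_hermitian[OF X] e
    by (simp add: hermitian_mat_def)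
  then have "cnj z = z" using e by simp
  then show z: "z = of_real (Re z)"
    by (metis Reals_cnj_iff complex_is_Real_iff of_real_Re)
  have "0 \<le> e \<bullet> (z *s e)" using psd_nonneg[OF X, of e] e by simp
  also have "\<dots> = Re z * (e \<bullet> e)"
    by (subst z) (simp flip: scaleR_eq_smult)
  finally show "0 \<le> Re z" using e by (simp add: zero_le_mult_iff) (metis inner_gt_zero_iff not_le)
qed

text \<open>Replace each eigenvalue in the spectral decomposition by its square root. Then
  \<open>R ** R\<close> and \<open>X\<close> agree on every component
  \<open>spectral_proj X z *v x\<close>, and these components add up to \<open>x\<close>.\<close>

lemma psd_sqrt_exists:
  assumes X: "psd X"
  shows "\<exists>R. psd R \<and> R ** R = X"
proof -
  have N: "normal_mat X" using X by (intro hermitian_normal psd_hermitian)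
  define R where "R = (\<Sum>z\<in>spectrum X. sqrt (Re z) *\<^sub>R spectral_proj X z)"
  have Rv: "R *v x = (\<Sum>z\<in>spectrum X. sqrt (Re z) *\<^sub>R (spectral_proj X z *v x))" for x
    by (simp add: R_def matrix_vector_sum scaleR_matrix_vector)
  have spec: "z = of_real (Re z)" "0 \<le> Re z" if "z \<in> spectrum X" for z
    using that psd_eigenvalue[OF X] by (auto simp: spectrum_def)
  have "hermitian_mat R"
    by (simp add: hermitian_iff Rv inner_sum_left inner_sum_right spectral_proj_hermitian)
  moreover have "0 \<le> v \<bullet> (R *v v)" for v
  proof -
    have "0 \<le> v \<bullet> (spectral_proj X z *v v)" for z
      using inner_ge_zero[of "spectral_proj X z *v v"]
      by (simp add: spectral_proj_hermitian spectral_proj_idem)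
    then show ?thesis
      by (auto simp: Rv inner_sum_right spec(2) intro!: sum_nonneg mult_nonneg_nonneg)
  qed
  moreover have "R ** R = X"
    unfolding matrix_eq
  proof
    fix x
    have R: "R *v (spectral_proj X z *v x) = sqrt (Re z) *\<^sub>R (spectral_proj X z *v x)" for z
      unfolding Rv by (rule sum_spectral_proj_eigenvector[OF N spectral_proj_eigen])
    have "(R ** R) *v x = (\<Sum>z\<in>spectrum X. sqrt (Re z) *\<^sub>R (R *v (spectral_proj X z *v x)))"
      by (simp add: Rv[of x] matrix_vector_sum_right matrix_vector_scaleR
          flip: matrix_vector_mul_assoc)
    also have "\<dots> = (\<Sum>z\<in>spectrum X. X *v (spectral_proj X z *v x))"
    proof (rule sum.cong)
      fix z assume z: "z \<in> spectrum X"
      have "sqrt (Re z) *\<^sub>R (R *v (spectral_proj X z *v x)) = Re z *\<^sub>R (spectral_proj X z *v x)"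
        using spec(2)[OF z] by (simp add: R)
      also have "\<dots> = X *v (spectral_proj X z *v x)"
        by (simp add: scaleR_eq_smult spectral_proj_eigen flip: spec(1)[OF z])
      finally show "sqrt (Re z) *\<^sub>R (R *v (spectral_proj X z *v x)) = X *v (spectral_proj X z *v x)" .
    qed simp
    also have "\<dots> = X *v x"
      by (simp add: spectral_decomposition[OF N] flip: matrix_vector_sum_right)
    finally show "(R ** R) *v x = X *v x" .
  qed
  ultimately show ?thesis by (auto simp: psd_iff)
qed

text \<open>Let \<open>l\<close> be the top eigenvalue of \<open>H = R - T\<close>, with unit
  eigenvector \<open>v\<close>. Evaluating \<open>R H + H T = R R - T T = 0\<close> at
  \<open>v\<close> gives \<open>l * (v \<bullet> (R *v v) + v \<bullet> (T *v v)) = 0\<close>. If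
  \<open>l\<close> were nonzero, both forms would vanish, so \<open>R\<close> and \<open>T\<close>,
  hence \<open>H\<close>, would kill \<open>v\<close>. Thus \<open>l = 0\<close> bounds the form of
  \<open>H\<close>.\<close>

lemma psd_sqrt_le:
  assumes R: "psd R" and T: "psd T" and eq: "R ** R = T ** T"
  shows "w \<bullet> (R *v w) \<le> w \<bullet> (T *v w)"
proof (cases "w = 0")
  case False
  define H where "H = R - T"
  have Hv: "H *v x = R *v x - T *v x" for x
    by (simp add: H_def matrix_vector_mult_diff_rdistrib)
  have hR: "(R *v x) \<bullet> y = x \<bullet> (R *v y)" and hT: "(T *v x) \<bullet> y = x \<bullet> (T *v y)" for x y
    using R T by (auto intro: hermitianD psd_hermitian)
  have "hermitian_mat H"
    by (simp add: hermitian_iff Hv inner_diff_left inner_diff_right hR hT)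
  then obtain v l where v: "norm v = 1" "H *v v = l *\<^sub>R v"
    and max: "\<And>w. w \<bullet> (H *v w) \<le> l * (w \<bullet> w)"
    using hermitian_max_eigenvector[of H UNIV w] False by auto
  have "l = 0"
  proof (rule ccontr)
    assume l: "l \<noteq> 0"
    have "l * (v \<bullet> (R *v v) + v \<bullet> (T *v v)) = (R *v v) \<bullet> (H *v v) + (H *v v) \<bullet> (T *v v)"
      by (simp add: v hR algebra_simps)
    also have "\<dots> = v \<bullet> ((R ** R) *v v) - v \<bullet> ((T ** T) *v v)"
      by (simp add: Hv inner_diff_left inner_diff_right hR hT flip: matrix_vector_mul_assoc)
    finally have "v \<bullet> (R *v v) + v \<bullet> (T *v v) = 0" using l eq by simp
    then have "v \<bullet> (R *v v) = 0" "v \<bullet> (T *v v) = 0"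
      using psd_nonneg[OF R, of v] psd_nonneg[OF T, of v] by linarith+
    then have "H *v v = 0" using R T by (simp add: Hv psd_form_zero)
    then show False using v l by auto
  qed
  then show ?thesis using max[of w] by (simp add: Hv inner_diff_right)
qed simp

text \<open>Using \<open>psd_sqrt_le\<close> in both directions, \<open>R - T\<close> has zero form,
  and a positive matrix kills every vector at which its form vanishes.\<close>

lemma psd_sqrt_unique:
  assumes R: "psd R" and T: "psd T" and eq: "R ** R = T ** T"
  shows "R = T"
proof -
  have 0: "v \<bullet> ((R - T) *v v) = 0" for v
    using psd_sqrt_le[OF R T eq, of v] psd_sqrt_le[OF T R eq[symmetric], of v]
    by (simp add: matrix_vector_mult_diff_rdistrib inner_diff_right)
  moreover have "psd (R - T)"
    using R T by (simp add: psd_iff 0 hermitian_mat_def conj_transpose_diff)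
  ultimately have "(R - T) *v v = 0" for v by (blast intro: psd_form_zero)
  then show ?thesis by (simp add: matrix_eq matrix_vector_mult_diff_rdistrib)
qed

lemma mat_sqrt_eq: "psd R \<Longrightarrow> R ** R = X \<Longrightarrow> mat_sqrt X = R"
  unfolding mat_sqrt_def by (rule the_equality) (auto intro: psd_sqrt_unique)

lemma psd_mat_sqrt: "psd X \<Longrightarrow> psd (mat_sqrt X)"
  and mat_sqrt_mult_self: "psd X \<Longrightarrow> mat_sqrt X ** mat_sqrt X = X"
  using psd_sqrt_exists[of X] by (metis mat_sqrt_eq)+

lemma conj_transpose_mat_sqrt: "psd X \<Longrightarrow> conj_transpose (mat_sqrt X) = mat_sqrt X"
  using psd_hermitian[OF psd_mat_sqrt] by (simp add: hermitian_mat_def)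

section \<open>Inverses and positive invertible matrices\<close>

lemma matrix_inv_right: "invertible A \<Longrightarrow> A ** matrix_inv A = mat 1"
  and matrix_inv_left: "invertible A \<Longrightarrow> matrix_inv A ** A = mat 1"
  for A :: "complex^'n^'n"
  unfolding invertible_def matrix_inv_def
  by (rule someI2_ex; simp)+

lemma matrix_inv_cancel:
  fixes A :: "complex^'n^'n"
  assumes "invertible A"
  shows "X ** A ** matrix_inv A = X" "X ** matrix_inv A ** A = X"
  using assms by (simp_all add: matrix_inv_right matrix_inv_left flip: matrix_mul_assoc)

lemma matrix_inv_eq:
  fixes A :: "complex^'n^'n"
  assumes "A ** B = mat 1"
  shows "matrix_inv A = B"
proof -
  have "invertible A" using assms invertible_right_inverse by blast
  then show ?thesis
    by (metis assms matrix_inv_left matrix_mul_assoc matrix_mul_lid matrix_mul_rid)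
qed

lemma invertible_matrix_inv: "invertible A \<Longrightarrow> invertible (matrix_inv A)"
  for A :: "complex^'n^'n"
  using matrix_inv_left invertible_right_inverse by blast

lemma conj_transpose_matrix_inv:
  fixes A :: "complex^'n^'n"
  assumes "invertible A"
  shows "conj_transpose (matrix_inv A) = matrix_inv (conj_transpose A)"
  by (rule matrix_inv_eq[symmetric])
    (simp add: matrix_inv_left[OF assms] flip: conj_transpose_mult)

lemma invertible_conj_transpose: "invertible A \<Longrightarrow> invertible (conj_transpose A)"
  for A :: "complex^'n^'n"
  by (metis conj_transpose_mat_1 conj_transpose_mult invertible_left_inverse matrix_inv_right)

lemma unitary_invertible: "unitary_mat U \<Longrightarrow> invertible U"
  by (auto simp: unitary_mat_def invertible_def)

lemma pos_invertible_congruence: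
  assumes "pos_invertible A" and "invertible C"
  shows "pos_invertible (conj_transpose C ** A ** C)"
  using assms
  by (simp add: pos_invertible_def psd_congruence invertible_mult invertible_conj_transpose)

lemma pos_invertible_mat_sqrt:
  assumes "pos_invertible X"
  shows "pos_invertible (mat_sqrt X)"
proof -
  have X: "psd X" "invertible X" using assms by (auto simp: pos_invertible_def)
  have "mat_sqrt X ** (mat_sqrt X ** matrix_inv X) = mat 1"
    by (simp add: matrix_mul_assoc mat_sqrt_mult_self X matrix_inv_right)
  then show ?thesis
    using X psd_mat_sqrt invertible_right_inverse by (auto simp: pos_invertible_def)
qed

lemma pos_invertible_matrix_inv:
  assumes "pos_invertible X"
  shows "pos_invertible (matrix_inv X)"
proof -
  have X: "psd X" "invertible X" using assms by (auto simp: pos_invertible_def)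
  have "conj_transpose (matrix_inv X) = matrix_inv X"
    using X psd_hermitian[OF X(1)] by (simp add: conj_transpose_matrix_inv hermitian_mat_def)
  then show ?thesis
    using psd_congruence[OF X(1), of "matrix_inv X"] X
    by (simp add: pos_invertible_def invertible_matrix_inv matrix_inv_left)
qed

section \<open>The geometric mean as the positive solution of a Riccati equation\<close>

lemma matrix_inv_mult_self:
  fixes R :: "complex^'n^'n"
  assumes "invertible R" and "R ** R = S"
  shows "matrix_inv S = matrix_inv R ** matrix_inv R"
  using assms(1) unfolding assms(2)[symmetric]
  by (intro matrix_inv_eq) (simp add: matrix_mul_assoc matrix_inv_cancel matrix_inv_right)

text \<open>With \<open>R\<close> the root of \<open>S\<close>, the inverse of \<open>S\<close> is
  the square of the inverse of \<open>R\<close>. The inner factors \<open>R\<close> then cancel,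
  leaving \<open>R ?Q R = T\<close>.\<close>

lemma
  assumes S: "pos_invertible S" and T: "psd T"
  shows psd_geom_mean: "psd (geom_mean S T)"
    and geom_mean_riccati: "geom_mean S T ** matrix_inv S ** geom_mean S T = T"
proof -
  let ?R = "mat_sqrt S"
  let ?I = "matrix_inv ?R"
  let ?Q = "?I ** T ** ?I"
  have R: "psd ?R" "invertible ?R" "?R ** ?R = S"
    using pos_invertible_mat_sqrt[OF S] S by (auto simp: pos_invertible_def mat_sqrt_mult_self)
  have ctR: "conj_transpose ?R = ?R" using S by (simp add: conj_transpose_mat_sqrt pos_invertible_def)
  then have "conj_transpose ?I = ?I" using R by (simp add: conj_transpose_matrix_inv)
  then have Q: "psd ?Q" using psd_congruence[OF T, of ?I] by simp
  show "psd (geom_mean S T)"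
    using psd_congruence[OF psd_mat_sqrt[OF Q], of ?R] by (simp add: geom_mean_def ctR)
  have "matrix_inv S = ?I ** ?I"
    by (rule matrix_inv_mult_self[OF R(2,3)])
  then have "geom_mean S T ** matrix_inv S ** geom_mean S T = ?R ** (mat_sqrt ?Q ** mat_sqrt ?Q) ** ?R"
    by (simp add: geom_mean_def matrix_mul_assoc matrix_inv_cancel R(2))
  also have "\<dots> = T"
    by (simp add: mat_sqrt_mult_self[OF Q])
      (simp add: matrix_mul_assoc matrix_inv_cancel matrix_inv_right R(2))
  finally show "geom_mean S T ** matrix_inv S ** geom_mean S T = T" .
qed

text \<open>For a positive solution \<open>G\<close>, the matrix \<open>?I ** G ** ?I\<close> is a
  positive square root of \<open>?I ** T ** ?I\<close>. Uniqueness of that root identifies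
  \<open>G\<close>.\<close>

lemma geom_mean_eq:
  assumes S: "pos_invertible S" and G: "psd G" and eq: "G ** matrix_inv S ** G = T"
  shows "geom_mean S T = G"
proof -
  let ?R = "mat_sqrt S"
  let ?I = "matrix_inv ?R"
  have R: "psd ?R" "invertible ?R" "?R ** ?R = S"
    using pos_invertible_mat_sqrt[OF S] S by (auto simp: pos_invertible_def mat_sqrt_mult_self)
  have "conj_transpose ?I = ?I"
    using R S by (simp add: conj_transpose_matrix_inv conj_transpose_mat_sqrt pos_invertible_def)
  then have Y: "psd (?I ** G ** ?I)" using psd_congruence[OF G, of ?I] by simp
  have "matrix_inv S = ?I ** ?I"
    by (rule matrix_inv_mult_self[OF R(2,3)])
  then have "(?I ** G ** ?I) ** (?I ** G ** ?I) = ?I ** T ** ?I"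
    by (simp add: eq[symmetric] matrix_mul_assoc)
  then have "mat_sqrt (?I ** T ** ?I) = ?I ** G ** ?I" by (rule mat_sqrt_eq[OF Y])
  then show ?thesis
    by (simp add: geom_mean_def matrix_mul_assoc matrix_inv_cancel matrix_inv_right R(2))
qed

text \<open>In the Riccati equation for the transformed pair the inner factors \<open>C\<close> and
  \<open>?C'\<close> cancel against those of the inverse, which reduces it to the equation for
  \<open>S\<close> and \<open>T\<close>.\<close>

lemma geom_mean_congruence:
  assumes S: "pos_invertible S" and T: "psd T" and C: "invertible C"
  shows "geom_mean (conj_transpose C ** S ** C) (conj_transpose C ** T ** C)
      = conj_transpose C ** geom_mean S T ** C"
proof (rule geom_mean_eq)
  let ?C' = "conj_transpose C"
  have C': "invertible ?C'" by (rule invertible_conj_transpose[OF C])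
  have S': "invertible S" using S by (simp add: pos_invertible_def)
  have "matrix_inv (?C' ** S ** C) = matrix_inv C ** matrix_inv S ** matrix_inv ?C'"
    by (rule matrix_inv_eq) (simp add: matrix_mul_assoc matrix_inv_cancel matrix_inv_right C C' S')
  then have "(?C' ** geom_mean S T ** C) ** matrix_inv (?C' ** S ** C) ** (?C' ** geom_mean S T ** C)
      = ?C' ** (geom_mean S T ** matrix_inv S ** geom_mean S T) ** C"
    by (simp add: matrix_mul_assoc matrix_inv_cancel C C')
  then show "(?C' ** geom_mean S T ** C) ** matrix_inv (?C' ** S ** C) ** (?C' ** geom_mean S T ** C)
      = ?C' ** T ** C"
    by (simp add: geom_mean_riccati[OF S T])
qed (intro pos_invertible_congruence psd_congruence psd_geom_mean S T C)+

text \<open>Conjugating the root by \<open>U\<close> gives a positive root of the conjugated matrix,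
  which is \<open>X\<close> again, so uniqueness applies.\<close>

lemma unitary_mat_sqrt_commute:
  assumes U: "unitary_mat U" and X: "psd X" and comm: "U ** X = X ** U"
  shows "U ** mat_sqrt X = mat_sqrt X ** U"
proof -
  let ?U' = "conj_transpose U" and ?R = "mat_sqrt X"
  have UU: "?U' ** U = mat 1" "U ** ?U' = mat 1" using U by (auto simp: unitary_mat_def)
  have "(?U' ** ?R ** U) ** (?U' ** ?R ** U) = ?U' ** ?R ** (U ** ?U') ** ?R ** U"
    by (simp add: matrix_mul_assoc)
  also have "\<dots> = ?U' ** (?R ** ?R) ** U" by (simp add: UU matrix_mul_assoc)
  also have "\<dots> = ?U' ** (U ** X)" by (simp add: mat_sqrt_mult_self X comm matrix_mul_assoc)
  also have "\<dots> = X" by (simp add: UU matrix_mul_assoc)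
  finally have "?R = ?U' ** ?R ** U"
    using psd_congruence[OF psd_mat_sqrt[OF X], of U] mat_sqrt_eq by blast
  then have "U ** ?R = U ** (?U' ** ?R ** U)" by simp
  also have "\<dots> = (U ** ?U') ** ?R ** U" by (simp only: matrix_mul_assoc)
  finally show ?thesis by (simp add: UU)
qed

section \<open>The three assertions\<close>

lemma normal_unitary: "unitary_mat U \<Longrightarrow> normal_mat U"
  by (simp add: unitary_mat_def normal_mat_def)

lemma op_norm_nonneg: "0 \<le> op_norm M"
  unfolding op_norm_def by (rule onorm_pos_le) (rule matrix_vector_mul_bounded_linear)

lemma op_norm_unitary_mult:
  assumes U: "unitary_mat U"
  shows "op_norm (U ** D) = op_norm D"
proof -
  have "(U *v x) \<bullet> (U *v x) = x \<bullet> x" for x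
    using U by (simp add: inner_conj_transpose matrix_vector_mul_assoc unitary_mat_def)
  then have "norm (U *v x) = norm x" for x by (simp add: norm_eq_sqrt_inner)
  then show ?thesis
    by (simp add: op_norm_def onorm_def flip: matrix_vector_mul_assoc)
qed

section \<open>Polar decomposition and the passage between assertions (1) and (2)\<close>

lemma commute_conj_transpose:
  assumes "hermitian_mat D" and "U ** D = D ** U"
  shows "conj_transpose U ** D = D ** conj_transpose U"
  using assms by (metis conj_transpose_mult hermitian_mat_def)

text \<open>The root \<open>C\<close> of \<open>D\<close> commutes with \<open>U\<close> and its
  adjoint. The second argument therefore collapses to
  \<open>C ** (?U' ** matrix_inv S ** U) ** C\<close>, and congruence by \<open>C\<close> pulls both
  outer factors out of the mean.\<close>

lemma geom_mean_polar:
  fixes S U D :: "complex^'n^'n"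
  assumes S: "pos_invertible S" and U: "unitary_mat U" and D: "pos_invertible D"
    and comm: "U ** D = D ** U"
  shows "geom_mean (mat_sqrt D ** S ** mat_sqrt D)
      (conj_transpose (U ** D) ** matrix_inv (mat_sqrt D ** S ** mat_sqrt D) ** (U ** D))
    = mat_sqrt D ** geom_mean S (conj_transpose U ** matrix_inv S ** U) ** mat_sqrt D"
proof -
  define C where "C = mat_sqrt D"
  let ?U' = "conj_transpose U"
  have D': "psd D" and S': "invertible S" using D S by (auto simp: pos_invertible_def)
  have C: "psd C" "invertible C" "C ** C = D"
    using pos_invertible_mat_sqrt[OF D] D' by (auto simp: C_def pos_invertible_def mat_sqrt_mult_self)
  have ctC: "conj_transpose C = C" using D' by (simp add: C_def conj_transpose_mat_sqrt)
  have UC: "U ** C = C ** U"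
    unfolding C_def by (rule unitary_mat_sqrt_commute[OF U D' comm])
  have U'C: "?U' ** C = C ** ?U'"
    by (rule commute_conj_transpose[OF psd_hermitian[OF C(1)] UC])
  have inv: "matrix_inv (C ** S ** C) = matrix_inv C ** matrix_inv S ** matrix_inv C"
    by (rule matrix_inv_eq) (simp add: matrix_mul_assoc matrix_inv_cancel matrix_inv_right C S')
  have UD: "U ** D = C ** C ** U" by (simp add: comm C)
  have "conj_transpose (U ** D) = ?U' ** C ** C"
    by (simp add: UD conj_transpose_mult ctC matrix_mul_assoc)
  then have "conj_transpose (U ** D) ** matrix_inv (C ** S ** C) ** (U ** D)
      = (?U' ** C) ** matrix_inv S ** (C ** U)"
    by (simp add: UD inv matrix_mul_assoc matrix_inv_cancel C(2))
  also have "\<dots> = C ** (?U' ** matrix_inv S ** U) ** C"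
    by (simp add: U'C matrix_mul_assoc flip: UC)
  finally have eq: "conj_transpose (U ** D) ** matrix_inv (C ** S ** C) ** (U ** D)
      = C ** (?U' ** matrix_inv S ** U) ** C" .
  have "psd (?U' ** matrix_inv S ** U)"
    using pos_invertible_matrix_inv[OF S] by (intro psd_congruence) (simp add: pos_invertible_def)
  from geom_mean_congruence[OF S this C(2)] show ?thesis
    by (simp add: ctC eq flip: C_def)
qed

text \<open>Take \<open>D\<close> as the root of \<open>X = ?B' ** B\<close> and
  \<open>U = B ** matrix_inv D\<close>. Normality makes \<open>B\<close> commute with
  \<open>X\<close>; hence so does \<open>U\<close>, which then commutes with the root
  \<open>D\<close> as well.\<close>

lemma polar_decomposition:
  assumes B: "normal_mat B" "invertible B"
  obtains U D where "unitary_mat U" "pos_invertible D" "U ** D = D ** U" "B = U ** D"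
proof -
  let ?B' = "conj_transpose B"
  define X where "X = ?B' ** B"
  have X: "pos_invertible X"
    using B by (simp add: X_def pos_invertible_def psd_conj_transpose_mult invertible_mult
        invertible_conj_transpose)
  then have X': "psd X" by (simp add: pos_invertible_def)
  define D where "D = mat_sqrt X"
  have D: "pos_invertible D" unfolding D_def by (rule pos_invertible_mat_sqrt[OF X])
  have inv: "invertible D" using D by (simp add: pos_invertible_def)
  have ctD: "conj_transpose D = D" using X' by (simp add: D_def conj_transpose_mat_sqrt)
  have DD: "D ** D = X" using X' by (simp add: D_def mat_sqrt_mult_self)
  define U where "U = B ** matrix_inv D"
  have BU: "B = U ** D" by (simp add: U_def matrix_inv_cancel inv)
  have "conj_transpose U ** U = matrix_inv D ** (?B' ** B) ** matrix_inv D"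
    by (simp add: U_def conj_transpose_mult conj_transpose_matrix_inv inv ctD matrix_mul_assoc)
  also have "\<dots> = matrix_inv D ** (D ** D) ** matrix_inv D" by (simp add: DD X_def)
  also have "\<dots> = mat 1"
    by (simp add: matrix_mul_assoc matrix_inv_cancel matrix_inv_left matrix_inv_right inv)
  finally have "conj_transpose U ** U = mat 1" .
  then have U: "unitary_mat U"
    unfolding unitary_mat_def using matrix_left_right_inverse by blast
  have "X ** B = (B ** ?B') ** B" using B(1) by (simp only: X_def normal_mat_def)
  then have BX: "B ** X = X ** B" by (simp add: X_def matrix_mul_assoc)
  have "U ** X = B ** D"
    by (simp add: U_def matrix_mul_assoc matrix_inv_cancel inv flip: DD)
  also have "\<dots> = B ** X ** matrix_inv D"
    by (simp add: matrix_mul_assoc matrix_inv_cancel inv flip: DD)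
  also have "\<dots> = X ** U" by (simp add: BX U_def matrix_mul_assoc)
  finally have "U ** D = D ** U"
    unfolding D_def by (rule unitary_mat_sqrt_commute[OF U X'])
  then show ?thesis using that U D BU by blast
qed

lemma normal_mult_commuting:
  assumes U: "unitary_mat U" and D: "hermitian_mat D" and comm: "U ** D = D ** U"
  shows "normal_mat (U ** D)"
proof -
  have "conj_transpose (U ** D) ** (U ** D) = D ** (conj_transpose U ** U) ** D"
    using D by (simp add: conj_transpose_mult hermitian_mat_def matrix_mul_assoc)
  moreover have "(U ** D) ** conj_transpose (U ** D) = D ** (U ** conj_transpose U) ** D"
    using D commute_conj_transpose[OF D comm]
    by (simp add: conj_transpose_mult hermitian_mat_def comm flip: matrix_mul_assoc)
  ultimately show ?thesis using U by (simp add: normal_mat_def unitary_mat_def)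
qed

text \<open>The form of the pinching at \<open>x\<close> is the sum of the forms of \<open>G\<close>
  at the spectral components of \<open>x\<close>, and \<open>x \<bullet> x\<close> is the sum of
  their squared lengths. An eigenvector has a single nonzero component at most.\<close>

lemma spectral_pinching_ge_1_iff:
  fixes N G :: "complex^'n^'n"
  assumes N: "normal_mat N" and G: "hermitian_mat G"
  shows "loewner_ge (spectral_pinching N G) (mat 1)
    \<longleftrightarrow> (\<forall>z e. N *v e = z *s e \<longrightarrow> e \<bullet> e \<le> e \<bullet> (G *v e))"
proof -
  define E where "E = spectral_pinching N G"
  let ?P = "\<lambda>z x. spectral_proj N z *v x"
  have Ev: "E *v x = (\<Sum>z\<in>spectrum N. ?P z (G *v ?P z x))" for x
    by (simp add: E_def spectral_pinching_def matrix_vector_sum flip: matrix_vector_mul_assoc)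
  have form: "x \<bullet> (E *v y) = (\<Sum>z\<in>spectrum N. ?P z x \<bullet> (G *v ?P z y))" for x y
    by (simp add: Ev inner_sum_right spectral_proj_hermitian)
  have "hermitian_mat E"
    by (simp add: hermitian_iff Ev inner_sum_left inner_sum_right spectral_proj_hermitian
        hermitianD[OF G])
  then have "loewner_ge E (mat 1) \<longleftrightarrow> (\<forall>x. x \<bullet> x \<le> x \<bullet> (E *v x))"
    by (simp add: loewner_ge_def psd_iff hermitian_mat_def conj_transpose_diff
        matrix_vector_mult_diff_rdistrib inner_diff_right)
  also have "\<dots> \<longleftrightarrow> (\<forall>z e. N *v e = z *s e \<longrightarrow> e \<bullet> e \<le> e \<bullet> (G *v e))"
  proof (intro iffI allI impI)
    fix z e assume le: "\<forall>x. x \<bullet> x \<le> x \<bullet> (E *v x)" and e: "N *v e = z *s e"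
    show "e \<bullet> e \<le> e \<bullet> (G *v e)"
    proof (cases "e = 0")
      case False
      then have z: "z \<in> spectrum N" using e by (auto simp: spectrum_def)
      have "e \<bullet> (E *v e) = (\<Sum>y\<in>spectrum N. if y = z then e \<bullet> (G *v e) else 0)"
        unfolding form
        by (rule sum.cong) (auto simp: spectral_proj_fix[OF e] spectral_proj_other[OF N e])
      also have "\<dots> = e \<bullet> (G *v e)" using z finite_spectrum[OF N] by simp
      finally show ?thesis using le[rule_format, of e] by simp
    qed simp
  next
    fix x assume le: "\<forall>z e. N *v e = z *s e \<longrightarrow> e \<bullet> e \<le> e \<bullet> (G *v e)"
    have "x \<bullet> x = x \<bullet> (\<Sum>z\<in>spectrum N. ?P z x)" by (simp add: spectral_decomposition[OF N])
    also have "\<dots> = (\<Sum>z\<in>spectrum N. ?P z x \<bullet> ?P z x)"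
      by (simp add: inner_sum_right spectral_proj_hermitian spectral_proj_idem)
    also have "\<dots> \<le> x \<bullet> (E *v x)"
      unfolding form by (intro sum_mono le[rule_format, OF spectral_proj_eigen])
    finally show "x \<bullet> x \<le> x \<bullet> (E *v x)" .
  qed
  finally show ?thesis by (simp add: E_def)
qed

text \<open>The step from (3) to (2). The top eigenspace of \<open>D\<close> is invariant under
  \<open>U\<close> and its adjoint, so it contains a unit eigenvector \<open>v\<close> of
  \<open>U\<close>. There the root of \<open>D\<close> acts as \<open>sqrt d\<close>, and the
  sandwiched form is \<open>d\<close> times that of \<open>G\<close>.\<close>

lemma op_norm_sandwich_ge:
  fixes U D G :: "complex^'n^'n"
  assumes U: "normal_mat U" and D: "psd D" and comm: "U ** D = D ** U"
    and G: "\<And>z e. U *v e = z *s e \<Longrightarrow> e \<bullet> e \<le> e \<bullet> (G *v e)"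
  shows "op_norm D \<le> op_norm (mat_sqrt D ** G ** mat_sqrt D)"
\<comment> \<open>The zero case is split off because \<open>psd_eigenvector_of_square\<close> asks
  for \<open>0 < sqrt d\<close>.\<close>
proof (cases "op_norm D = 0")
  case True
  then show ?thesis by (simp add: op_norm_nonneg)
next
  case False
  define d where "d = op_norm D"
  have d: "0 < d" using False op_norm_nonneg[of D] by (simp add: d_def)
  let ?C = "mat_sqrt D"
  let ?W = "eigenspace D (of_real d)"
  have inv: "A *v w \<in> ?W" if "A ** D = D ** A" "w \<in> ?W" for A w
  proof -
    have "D *v (A *v w) = A *v (D *v w)" using that(1) by (simp add: matrix_vector_mul_assoc)
    then show ?thesis using that(2) by (simp add: eigenspace_def vector_scalar_commute)
  qed
  obtain x where "norm x = 1" "D *v x = d *\<^sub>R x"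
    unfolding d_def by (rule psd_norm_eigenvector[OF D])
  then have x: "x \<in> ?W" "x \<noteq> 0" by (auto simp: eigenspace_def scaleR_eq_smult)
  obtain v z where v: "v \<in> ?W" "norm v = 1" "U *v v = z *s v"
    by (rule normal_eigenvector[OF U vec_subspace_eigenspace inv[OF comm]
        inv[OF commute_conj_transpose[OF psd_hermitian[OF D] comm]] x])
  have "?C *v (?C *v v) = (sqrt d)\<^sup>2 *\<^sub>R v"
    using v(1) d by (simp add: matrix_vector_mul_assoc mat_sqrt_mult_self[OF D] eigenspace_def
        scaleR_eq_smult)
  then have Cv: "?C *v v = sqrt d *\<^sub>R v"
    by (rule psd_eigenvector_of_square[OF psd_mat_sqrt[OF D]]) (simp add: d)
  have "v \<bullet> ((?C ** G ** ?C) *v v) = (?C *v v) \<bullet> (G *v (?C *v v))"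
    by (simp add: hermitianD[OF psd_hermitian[OF psd_mat_sqrt[OF D]]] flip: matrix_vector_mul_assoc)
  also have "\<dots> = d * (v \<bullet> (G *v v))" using d by (simp add: Cv matrix_vector_scaleR)
  finally have "d * (v \<bullet> (G *v v)) \<le> op_norm (?C ** G ** ?C)"
    using inner_le_op_norm[of v "?C ** G ** ?C"] v(2) by (simp add: dot_square_norm)
  moreover have "1 \<le> v \<bullet> (G *v v)" using G[OF v(3)] v(2) by (simp add: dot_square_norm)
  then have "d * 1 \<le> d * (v \<bullet> (G *v v))" using d by (intro mult_left_mono) auto
  ultimately show ?thesis by (simp add: d_def)
qed

text \<open>The step from (2) to (3). The test matrices \<open>T (t * t)\<close> have norm at least
  1, while their roots \<open>T t\<close> tend to the projection \<open>P\<close> onto the line of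
  \<open>u\<close>, where \<open>G\<close> compresses to
  \<open>u \<bullet> (G *v u)\<close>.\<close>

lemma eigenvector_form_ge_1:
  fixes U G :: "complex^'n^'n"
  assumes U: "normal_mat U" and G: "psd G"
    and le: "\<And>D. pos_invertible D \<Longrightarrow> U ** D = D ** U
      \<Longrightarrow> op_norm D \<le> op_norm (mat_sqrt D ** G ** mat_sqrt D)"
    and u: "U *v u = z *s u" "norm u = 1"
  shows "1 \<le> u \<bullet> (G *v u)"
proof -
  let ?W = "range (\<lambda>c. c *s u)"
  have "vec.subspace ?W"
    using vec.subspace_span[of "{u}"] by (simp only: vec.span_singleton)
  then obtain P where P: "hermitian_mat P" "P ** P = P" "range (\<lambda>v. P *v v) = ?W"
    using orth_projection_exists by blast
  have PP: "P *v (P *v x) = P *v x" for x by (simp add: matrix_vector_mul_assoc P)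
  have hP: "(P *v x) \<bullet> y = x \<bullet> (P *v y)" for x y by (rule hermitianD[OF P(1)])
  have P_fix: "P *v (c *s u) = c *s u" for c
  proof -
    have "c *s u \<in> range (\<lambda>v. P *v v)" unfolding P(3) by (rule rangeI)
    then show ?thesis using PP by auto
  qed
  then have Pu: "P *v u = u" by (metis vector_smult_lid)
  have P_range: "\<exists>c. P *v x = c *s u" for x
  proof -
    have "P *v x \<in> range (\<lambda>v. P *v v)" by (rule rangeI)
    then show ?thesis unfolding P(3) by blast
  qed
  \<comment> \<open>If \<open>u\<close> is an eigenvector of \<open>A\<close>, the range of
    \<open>A ** P\<close> lies in the line of \<open>u\<close>. Applying this to \<open>U\<close>
    and to its adjoint, and taking adjoints in the latter case, shows that \<open>U\<close> commutes
    with \<open>P\<close>.\<close>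
  have PAP: "P ** A ** P = A ** P" if "A *v u = y *s u" for A y
    unfolding matrix_eq
  proof
    fix x
    obtain c where "P *v x = c *s u" using P_range by blast
    then show "(P ** A ** P) *v x = (A ** P) *v x"
      by (simp add: that vector_scalar_commute vector_smult_assoc Pu
          flip: matrix_vector_mul_assoc)
  qed
  have "P ** conj_transpose U ** P = conj_transpose U ** P"
    by (rule PAP[OF normal_adjoint_eigenvector[OF U u(1)]])
  then have "conj_transpose (P ** conj_transpose U ** P) = conj_transpose (conj_transpose U ** P)"
    by simp
  then have "P ** U ** P = P ** U"
    using P(1) by (simp add: conj_transpose_mult hermitian_mat_def matrix_mul_assoc)
  then have "U ** P = P ** U" using PAP[OF u(1)] by simp
  then have UP: "U *v (P *v x) = P *v (U *v x)" for x by (simp add: matrix_vector_mul_assoc)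
  \<comment> \<open>On the line of \<open>u\<close> this is 1, on its complement \<open>t\<close>.
    Hence \<open>T\<close> is multiplicative in \<open>t\<close>, which yields both the inverse and
    the square root of \<open>T (t * t)\<close>.\<close>
  define T where "T t = P + t *\<^sub>R (mat 1 - P)" for t :: real
  have Tv: "T t *v x = P *v x + t *\<^sub>R (x - P *v x)" for t x
    by (simp add: T_def matrix_vector_mult_add_rdistrib scaleR_matrix_vector
        matrix_vector_mult_diff_rdistrib)
  have TT: "T s ** T t = T (s * t)" for s t
    by (simp add: matrix_eq Tv matrix_vector_right_distrib matrix_vector_mult_diff_distrib
        matrix_vector_scaleR PP flip: matrix_vector_mul_assoc)
  have T1: "T 1 = mat 1" by (simp add: T_def)
  have UT: "U ** T t = T t ** U" for t
    by (simp add: matrix_eq Tv matrix_vector_right_distrib matrix_vector_mult_diff_distrib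
        matrix_vector_scaleR UP flip: matrix_vector_mul_assoc)
  have hT: "(T t *v x) \<bullet> y = x \<bullet> (T t *v y)" for t x y
    by (simp add: Tv inner_add_left inner_add_right inner_diff_left inner_diff_right hP)
  have split: "(P *v x) \<bullet> (P *v x) + (x - P *v x) \<bullet> (x - P *v x) = x \<bullet> x" for x
    by (simp add: inner_diff_left inner_diff_right hP PP)
  have Tpsd: "psd (T t)" if "0 \<le> t" for t
    unfolding psd_iff
  proof (intro conjI allI)
    fix x
    have "x \<bullet> (T t *v x) = (P *v x) \<bullet> (P *v x) + t * ((x - P *v x) \<bullet> (x - P *v x))"
      by (simp add: Tv inner_add_right inner_diff_right inner_diff_left hP PP)
    then show "0 \<le> x \<bullet> (T t *v x)" using that by simp
  qed (simp add: hermitian_iff hT)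
  have bound: "1 \<le> u \<bullet> (G *v u) + 3 * t * op_norm G" if t: "0 < t" "t \<le> 1" for t
  proof -
    have "T (t * t) ** T (1 / (t * t)) = mat 1" using t by (simp add: TT T1)
    then have "pos_invertible (T (t * t))"
      using Tpsd[of "t * t"] t invertible_right_inverse by (auto simp: pos_invertible_def)
    then have "op_norm (T (t * t)) \<le> op_norm (mat_sqrt (T (t * t)) ** G ** mat_sqrt (T (t * t)))"
      by (rule le[OF _ UT])
    also have "mat_sqrt (T (t * t)) = T t"
      using t by (intro mat_sqrt_eq Tpsd TT) simp
    finally have "op_norm (T (t * t)) \<le> op_norm (T t ** G ** T t)" .
    moreover have "1 \<le> op_norm (T (t * t))"
      using inner_le_op_norm[of u "T (t * t)"] u(2) by (simp add: Tv Pu dot_square_norm)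
    ultimately have 1: "1 \<le> op_norm (T t ** G ** T t)" by simp
    have "conj_transpose (T t) = T t"
      using psd_hermitian[OF Tpsd[of t]] t by (simp add: hermitian_mat_def)
    then have "psd (T t ** G ** T t)" using psd_congruence[OF G, of "T t"] by simp
    \<comment> \<open>Positivity lets the norm be read off as the value of the form at a unit
      vector.\<close>
    then obtain v where v: "norm v = 1" "(T t ** G ** T t) *v v = op_norm (T t ** G ** T t) *\<^sub>R v"
      by (rule psd_norm_eigenvector)
    define a b where "a = P *v v" and "b = v - P *v v"
    have ab: "a \<bullet> a + b \<bullet> b = 1"
      using split[of v] v(1) by (simp add: a_def b_def dot_square_norm)
    have a1: "a \<bullet> a \<le> 1" and b1: "b \<bullet> b \<le> 1"
      using ab inner_ge_zero[of a] inner_ge_zero[of b] by linarith+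
    have "1 \<le> v \<bullet> ((T t ** G ** T t) *v v)" using 1 v by (simp add: dot_square_norm)
    also have "\<dots> = (T t *v v) \<bullet> (G *v (T t *v v))"
      by (simp add: hT flip: matrix_vector_mul_assoc)
    also have "\<dots> = a \<bullet> (G *v a) + 2 * t * (a \<bullet> (G *v b)) + t * t * (b \<bullet> (G *v b))"
    proof -
      have "T t *v v = a + t *\<^sub>R b" by (simp add: Tv a_def b_def)
      moreover have "b \<bullet> (G *v a) = a \<bullet> (G *v b)"
        by (metis G hermitianD inner_commute psd_hermitian)
      ultimately show ?thesis
        by (simp add: matrix_vector_right_distrib matrix_vector_scaleR inner_add_left
            inner_add_right distrib_left)
    qed
    also have "\<dots> \<le> u \<bullet> (G *v u) + 2 * t * op_norm G + t * op_norm G"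
    proof (intro add_mono)
      \<comment> \<open>As \<open>a\<close> lies on the line of \<open>u\<close> with length at most
        1, and \<open>u \<bullet> (G *v u)\<close> is nonnegative, the main term is at most that
        value. The cross term is bounded by Cauchy-Schwarz, the last one using
        \<open>t * t \<le> t\<close>.\<close>
      obtain c where c: "a = c *s u" using P_range a_def by blast
      have "u \<bullet> u = 1" using u(2) by (simp add: dot_square_norm)
      then have "(cmod c)\<^sup>2 \<le> 1" using a1 by (simp add: c inner_smult_smult)
      then show "a \<bullet> (G *v a) \<le> u \<bullet> (G *v u)"
        using psd_nonneg[OF G, of u]
        by (simp add: c vector_scalar_commute inner_smult_smult mult_left_le_one_le)
      have "norm a \<le> 1" "norm b \<le> 1"
        using a1 b1 by (simp_all add: norm_eq_sqrt_inner)
      have "a \<bullet> (G *v b) \<le> norm a * norm (G *v b)" by (rule norm_cauchy_schwarz)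
      also have "\<dots> \<le> 1 * (op_norm G * 1)"
        using \<open>norm a \<le> 1\<close> \<open>norm b \<le> 1\<close> op_norm_nonneg[of G]
        by (intro mult_mono order_trans[OF norm_le_op_norm] mult_nonneg_nonneg) auto
      finally show "2 * t * (a \<bullet> (G *v b)) \<le> 2 * t * op_norm G"
        using t by (intro mult_left_mono) auto
      have "b \<bullet> (G *v b) \<le> op_norm G * (b \<bullet> b)" by (rule inner_le_op_norm)
      also have "\<dots> \<le> op_norm G * 1"
        using b1 op_norm_nonneg by (intro mult_left_mono)
      finally have "t * t * (b \<bullet> (G *v b)) \<le> t * t * op_norm G"
        using t by (intro mult_left_mono) auto
      also have "\<dots> \<le> t * op_norm G"
        using t op_norm_nonneg by (intro mult_right_mono mult_left_le) auto
      finally show "t * t * (b \<bullet> (G *v b)) \<le> t * op_norm G" .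
    qed
    finally show ?thesis by simp
  qed
  show ?thesis
  proof (rule field_le_epsilon)
    fix e :: real assume e: "0 < e"
    let ?K = "op_norm G"
    \<comment> \<open>This makes the error \<open>3 * t * ?K\<close> at most \<open>e\<close>. The
      added 1 avoids division by 0 when \<open>?K = 0\<close>.\<close>
    define t where "t = min 1 (e / (3 * ?K + 1))"
    have K: "0 < 3 * ?K + 1" using op_norm_nonneg[of G] by simp
    then have t: "0 < t" "t \<le> 1" using e by (auto simp: t_def)
    have "t * (3 * ?K + 1) \<le> e" using K by (simp add: t_def pos_le_divide_eq[symmetric])
    then have "3 * t * ?K \<le> e" using t by (simp add: algebra_simps)
    then show "1 \<le> u \<bullet> (G *v u) + e" using bound[OF t] by simp
  qed
qed

lemma eigenvector_form_ge:
  fixes U G :: "complex^'n^'n"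
  assumes "normal_mat U" and "psd G"
    and "\<And>D. pos_invertible D \<Longrightarrow> U ** D = D ** U
      \<Longrightarrow> op_norm D \<le> op_norm (mat_sqrt D ** G ** mat_sqrt D)"
    and e: "U *v e = z *s e"
  shows "e \<bullet> e \<le> e \<bullet> (G *v e)"
proof (cases "e = 0")
  case False
  define u where "u = (1 / norm e) *\<^sub>R e"
  have eu: "e = norm e *\<^sub>R u" using False by (simp add: u_def)
  have "U *v u = z *s u"
    by (simp add: u_def matrix_vector_scaleR e) (simp add: scaleR_eq_smult vector_smult_assoc mult.commute)
  moreover have "norm u = 1" using False by (simp add: u_def)
  ultimately have "1 \<le> u \<bullet> (G *v u)" using eigenvector_form_ge_1[OF assms(1-3)] by blast
  then have "(norm e)\<^sup>2 * 1 \<le> (norm e)\<^sup>2 * (u \<bullet> (G *v u))" by (intro mult_left_mono) auto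
  also have "\<dots> = e \<bullet> (G *v e)"
    by (subst (2 3) eu) (simp add: matrix_vector_scaleR power2_eq_square)
  finally show ?thesis by (simp add: dot_square_norm)
qed simp

theorem theorem2p1:
  defines "assertion1 \<equiv>
    (\<forall>A B :: complex^'n^'n. pos_invertible A \<longrightarrow> normal_mat B \<longrightarrow> invertible B \<longrightarrow>
       op_norm (geom_mean A (conj_transpose B ** matrix_inv A ** B)) \<ge> op_norm B)"
  defines "assertion2 \<equiv>
    (\<forall>S U D :: complex^'n^'n. pos_invertible S \<longrightarrow> unitary_mat U \<longrightarrow> pos_invertible D \<longrightarrow>
       U ** D = D ** U \<longrightarrow>
       op_norm (mat_sqrt D ** geom_mean S (conj_transpose U ** matrix_inv S ** U) ** mat_sqrt D)
         \<ge> op_norm D)"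
  defines "assertion3 \<equiv>
    (\<forall>S U :: complex^'n^'n. pos_invertible S \<longrightarrow> unitary_mat U \<longrightarrow>
       loewner_ge (spectral_pinching U (geom_mean S (conj_transpose U ** matrix_inv S ** U)))
         (mat 1))"
  shows "(assertion1 \<longleftrightarrow> assertion2) \<and> (assertion2 \<longleftrightarrow> assertion3)"
proof (intro conjI iffI)
  assume 1: assertion1
  show assertion2
    unfolding assertion2_def
  proof (intro allI impI)
    fix S U D :: "complex^'n^'n"
    assume S: "pos_invertible S" and U: "unitary_mat U" and D: "pos_invertible D"
      and comm: "U ** D = D ** U"
    let ?C = "mat_sqrt D"
    have C: "invertible ?C" using pos_invertible_mat_sqrt[OF D] by (simp add: pos_invertible_def)
    have D': "psd D" "invertible D" using D by (auto simp: pos_invertible_def)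
    have "pos_invertible (?C ** S ** ?C)"
      using pos_invertible_congruence[OF S C] D' by (simp add: conj_transpose_mat_sqrt)
    moreover have "normal_mat (U ** D)"
      by (rule normal_mult_commuting[OF U psd_hermitian[OF D'(1)] comm])
    moreover have "invertible (U ** D)"
      using U D' by (simp add: invertible_mult unitary_invertible)
    ultimately have "op_norm (U ** D) \<le> op_norm (geom_mean (?C ** S ** ?C)
        (conj_transpose (U ** D) ** matrix_inv (?C ** S ** ?C) ** (U ** D)))"
      using 1 unfolding assertion1_def by blast
    then show "op_norm D \<le>
        op_norm (?C ** geom_mean S (conj_transpose U ** matrix_inv S ** U) ** ?C)"
      by (simp only: geom_mean_polar[OF S U D comm] op_norm_unitary_mult[OF U])
  qed
next
  assume 2: assertion2
  show assertion1
    unfolding assertion1_def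
  proof (intro allI impI)
    fix A B :: "complex^'n^'n"
    assume A: "pos_invertible A" and B: "normal_mat B" "invertible B"
    obtain U D where U: "unitary_mat U" and D: "pos_invertible D" and comm: "U ** D = D ** U"
      and UD: "B = U ** D"
      using polar_decomposition[OF B] by blast
    let ?C = "mat_sqrt D"
    \<comment> \<open>Chosen so that \<open>?C ** S ** ?C = A\<close>, the form in which
      \<open>geom_mean_polar\<close> applies.\<close>
    define S where "S = matrix_inv ?C ** A ** matrix_inv ?C"
    have C: "pos_invertible ?C" "invertible ?C"
      using pos_invertible_mat_sqrt[OF D] by (auto simp: pos_invertible_def)
    then have I: "invertible (matrix_inv ?C)" "conj_transpose (matrix_inv ?C) = matrix_inv ?C"
      using pos_invertible_matrix_inv[OF C(1)] psd_hermitian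
      by (auto simp: pos_invertible_def hermitian_mat_def)
    have S: "pos_invertible S"
      using pos_invertible_congruence[OF A I(1)] by (simp add: S_def I(2))
    have "?C ** S ** ?C = A"
      by (simp add: S_def matrix_mul_assoc matrix_inv_cancel matrix_inv_right C)
    then have "geom_mean A (conj_transpose B ** matrix_inv A ** B)
        = ?C ** geom_mean S (conj_transpose U ** matrix_inv S ** U) ** ?C"
      using geom_mean_polar[OF S U D comm] by (simp add: UD)
    moreover have "op_norm B = op_norm D" by (simp only: UD op_norm_unitary_mult[OF U])
    ultimately show "op_norm B \<le> op_norm (geom_mean A (conj_transpose B ** matrix_inv A ** B))"
      using 2 S U D comm by (simp add: assertion2_def)
  qed
next
  have G: "psd (geom_mean S (conj_transpose U ** matrix_inv S ** U))"
    if "pos_invertible S" for S U :: "complex^'n^'n"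
    using pos_invertible_matrix_inv[OF that] that
    by (intro psd_geom_mean psd_congruence) (auto simp: pos_invertible_def)
  {
    assume 2: assertion2
    show assertion3
      unfolding assertion3_def
    proof (intro allI impI)
      fix S U :: "complex^'n^'n"
      assume S: "pos_invertible S" and U: "unitary_mat U"
      let ?G = "geom_mean S (conj_transpose U ** matrix_inv S ** U)"
      \<comment> \<open>For fixed \<open>S\<close> and \<open>U\<close>, (2) supplies the norm bound
        for the whole family of commuting \<open>D\<close> at once.\<close>
      have "e \<bullet> e \<le> e \<bullet> (?G *v e)" if "U *v e = z *s e" for e z
        using eigenvector_form_ge[OF normal_unitary[OF U] G[OF S, of U] _ that] 2 S U
        by (simp add: assertion2_def)
      then show "loewner_ge (spectral_pinching U ?G) (mat 1)"
        unfolding spectral_pinching_ge_1_iff[OF normal_unitary[OF U] psd_hermitian[OF G[OF S]]]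
        by blast
    qed
  next
    assume 3: assertion3
    show assertion2
      unfolding assertion2_def
    proof (intro allI impI)
      fix S U D :: "complex^'n^'n"
      assume S: "pos_invertible S" and U: "unitary_mat U" and D: "pos_invertible D"
        and comm: "U ** D = D ** U"
      show "op_norm D \<le> op_norm (mat_sqrt D ** geom_mean S (conj_transpose U ** matrix_inv S ** U)
          ** mat_sqrt D)"
      proof (rule op_norm_sandwich_ge[OF normal_unitary[OF U] _ comm])
        let ?G = "geom_mean S (conj_transpose U ** matrix_inv S ** U)"
        show "psd D" using D by (simp add: pos_invertible_def)
        have "loewner_ge (spectral_pinching U ?G) (mat 1)"
          using 3 S U by (simp add: assertion3_def)
        then show "e \<bullet> e \<le> e \<bullet> (?G *v e)" if "U *v e = z *s e" for e z
          using that
          unfolding spectral_pinching_ge_1_iff[OF normal_unitary[OF U] psd_hermitian[OF G[OF S]]]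
          by blast
      qed
    qed
  }
qed

end
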